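(* Let $H$ be an $n$-qubit Hamiltonian with spectral decomposition $H=\sum_i E_i|E_i\rangle\langle E_i|$, and let $|\psi\rangle$ be an $n$-qubit state. Define the probability measure $p$ on $\mathbb{R}$ as $$p(x)=\sum_i p_i\,\delta(x-E_i),\qquad p_i=|\langle E_i|\psi\rangle|^2,$$ where $\delta$ denotes the Dirac delta function. Furthermore, let $\nu$ and $\mu$ be two probability density functions on $\mathbb{R}$ such that $\mathrm{supp}(p\ast\nu)\subset\mathrm{supp}(\mu)$, where $\ast$ denotes convolution. Finally, assume that there exists a constant $M\in\mathbb{C}$ such that for every $x\in\mathrm{supp}(\mu)$ we have access to a $(1,m,0)$-block-encoding $U_x$ of an operator $h(H-xI)$ which satisfies $$|h(H-xI)|^2=\frac{\nu(H-xI)}{|M|^2\mu(x)},\qquad \|h(H-xI)\|\le 1,$$ and that we can generate samples distributed according to $\mu$. Then we can generate a sample distributed according to $p\ast\nu$ from an expected $|M|^2$ uses of such $U_x$'s.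
   Context: An $(n+m)$-qubit unitary $U$ is an $(\alpha,m,\epsilon)$-block-encoding of an $n$-qubit linear operator $A$ if $\|A-\alpha(\langle 0^m|\otimes I)U(|0^m\rangle\otimes I)\|\le\epsilon$. Functions of $H$ are understood through the spectral decomposition, $f(H)=\sum_i f(E_i)|E_i\rangle\langle E_i|$. The density of $p\ast\nu$ is $(p\ast\nu)(x)=\sum_i p_i\,\nu(x-E_i)$. $\mathrm{supp}$ denotes the support. The sampling procedure may draw classical samples $x$ from $\mu$, prepare copies of $|0^m\rangle|\psi\rangle$, apply $U_x$ to them and measure the $m$ ancilla qubits.
   Formalization: Since p∗ν uses ν(x−E_i) while ν(H−xI) has eigenvalues ν(E_i−x), the claim as printed fails for general ν; it is proved either for even ν with the printed equation, or for any density ν with ν(xI−H) in place of ν(H−xI). *)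

theory Defs
  imports "HOL-Probability.Probability" "Jordan_Normal_Form.Schur_Decomposition"
begin

no_notation vec_nth (infixl \<open>$\<close> 90)
no_notation inner (infix \<open>\<bullet>\<close> 70)

section \<open>Linear algebra on qubits\<close>

definition l2_norm :: "complex vec \<Rightarrow> real" where
  "l2_norm v = sqrt (\<Sum>i<dim_vec v. (cmod (v $ i))\<^sup>2)"

definition op_norm :: "complex mat \<Rightarrow> real" where
  "op_norm A = Sup {l2_norm (A *\<^sub>v v) | v. v \<in> carrier_vec (dim_col A) \<and> l2_norm v = 1}"

definition unitary_mat :: "nat \<Rightarrow> complex mat \<Rightarrow> bool" where
  "unitary_mat N U \<longleftrightarrow>
     U \<in> carrier_mat N N \<and> mat_adjoint U * U = 1\<^sub>m N \<and> U * mat_adjoint U = 1\<^sub>m N"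

definition kron :: "complex mat \<Rightarrow> complex mat \<Rightarrow> complex mat" where
  "kron A B = mat (dim_row A * dim_row B) (dim_col A * dim_col B)
     (\<lambda>(i, j). A $$ (i div dim_row B, j div dim_col B) * B $$ (i mod dim_row B, j mod dim_col B))"

text \<open>The column matrix of the computational basis state of \<open>m\<close> qubits whose bit string is the
  binary expansion of \<open>a < 2 ^ m\<close>; in particular \<open>ket m 0\<close> is the all-zero state.\<close>

definition ket :: "nat \<Rightarrow> nat \<Rightarrow> complex mat" where
  "ket m a = mat (2 ^ m) 1 (\<lambda>(i, j). if i = a then 1 else 0)"

text \<open>The ancilla register is the left tensor factor: \<open>ancilla_ket n m a\<close> is
  \<open>|a> \<otimes> I\<close>, mapping an \<open>n\<close>-qubit state \<open>\<psi>\<close> to \<open>|a>|\<psi>>\<close>, and its adjoint is \<open><a| \<otimes> I\<close>.\<close>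

definition ancilla_ket :: "nat \<Rightarrow> nat \<Rightarrow> nat \<Rightarrow> complex mat" where
  "ancilla_ket n m a = kron (ket m a) (1\<^sub>m (2 ^ n))"

definition ancilla_bra :: "nat \<Rightarrow> nat \<Rightarrow> nat \<Rightarrow> complex mat" where
  "ancilla_bra n m a = kron (mat_adjoint (ket m a)) (1\<^sub>m (2 ^ n))"

definition block_encoding ::
  "nat \<Rightarrow> complex \<Rightarrow> nat \<Rightarrow> real \<Rightarrow> complex mat \<Rightarrow> complex mat \<Rightarrow> bool" where
  "block_encoding n \<alpha> m \<epsilon> A U \<longleftrightarrow>
     unitary_mat (2 ^ (n + m)) U \<and> A \<in> carrier_mat (2 ^ n) (2 ^ n) \<and>
     op_norm (A - \<alpha> \<cdot>\<^sub>m (ancilla_bra n m 0 * U * ancilla_ket n m 0)) \<le> \<epsilon>"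

definition qubit_state :: "nat \<Rightarrow> complex vec \<Rightarrow> bool" where
  "qubit_state n \<psi> \<longleftrightarrow> \<psi> \<in> carrier_vec (2 ^ n) \<and> l2_norm \<psi> = 1"

section \<open>Spectral decomposition and functions of Hermitian operators\<close>

text \<open>\<open>spectral_sum N c e\<close> is \<open>\<Sum>i<N. c i |e i><e i|\<close>.\<close>

definition spectral_sum :: "nat \<Rightarrow> (nat \<Rightarrow> complex) \<Rightarrow> (nat \<Rightarrow> complex vec) \<Rightarrow> complex mat" where
  "spectral_sum N c e = mat N N (\<lambda>(k, l). \<Sum>i<N. c i * (e i $ k) * cnj (e i $ l))"

text \<open>Eigenvalues are listed with multiplicity, so \<open>e\<close> is an orthonormal basis. Since the \<open>E i\<close>
  are real, an operator with such a decomposition is Hermitian.\<close>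

definition spectral_decomposition ::
  "nat \<Rightarrow> complex mat \<Rightarrow> (nat \<Rightarrow> real) \<Rightarrow> (nat \<Rightarrow> complex vec) \<Rightarrow> bool" where
  "spectral_decomposition N A E e \<longleftrightarrow>
     (\<forall>i<N. e i \<in> carrier_vec N) \<and>
     (\<forall>i<N. \<forall>j<N. e i \<bullet>c e j = (if i = j then 1 else 0)) \<and>
     A = spectral_sum N (\<lambda>i. complex_of_real (E i)) e"

text \<open>The description determines a unique matrix: see \<open>op_fun_eq\<close> below.\<close>

definition op_fun :: "(real \<Rightarrow> complex) \<Rightarrow> complex mat \<Rightarrow> complex mat" where
  "op_fun f A = (THE B. \<exists>E e. spectral_decomposition (dim_row A) A E e \<and>
                              B = spectral_sum (dim_row A) (\<lambda>i. f (E i)) e)"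

definition scalar_op :: "nat \<Rightarrow> real \<Rightarrow> complex mat" where
  "scalar_op n x = complex_of_real x \<cdot>\<^sub>m 1\<^sub>m (2 ^ n)"

definition abs_sq :: "complex mat \<Rightarrow> complex mat" where
  "abs_sq A = mat_adjoint A * A"

lemma spectral_sum_factor:
  assumes e: "\<forall>i<N. e i \<in> carrier_vec N"
  defines "P \<equiv> mat N N (\<lambda>(k, i). e i $ k)"
  shows "spectral_sum N c e = P * mat N N (\<lambda>(i, j). if i = j then c i else 0) * mat_adjoint P"
proof (rule eq_matI)
  let ?D = "mat N N (\<lambda>(i, j). if i = j then c i else 0)"
  have P: "P \<in> carrier_mat N N" unfolding P_def by auto
  have adj: "mat_adjoint P \<in> carrier_mat N N"
    unfolding mat_adjoint_def using P by auto
  fix k l assume "k < dim_row (P * ?D * mat_adjoint P)" "l < dim_col (P * ?D * mat_adjoint P)"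
  hence k: "k < N" and l: "l < N" using P adj by auto
  have pd: "(P * ?D) $$ (k, i) = e i $ k * c i" if i: "i < N" for i
  proof -
    have "(P * ?D) $$ (k, i) = (\<Sum>j = 0..<N. P $$ (k, j) * ?D $$ (j, i))"
      using k i P by (simp add: scalar_prod_def)
    also have "\<dots> = (\<Sum>j = 0..<N. if j = i then e i $ k * c i else 0)"
      using k i by (intro sum.cong) (auto simp: P_def)
    finally show ?thesis using i by simp
  qed
  have ad: "mat_adjoint P $$ (i, l) = cnj (e i $ l)" if i: "i < N" for i
    unfolding mat_adjoint_def using P i l
    by (simp add: mat_of_rows_index) (simp add: P_def)
  have "(P * ?D * mat_adjoint P) $$ (k, l) = (\<Sum>i = 0..<N. (P * ?D) $$ (k, i) * mat_adjoint P $$ (i, l))"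
    using k l P adj by (simp add: scalar_prod_def)
  also have "\<dots> = (\<Sum>i<N. c i * e i $ k * cnj (e i $ l))"
    unfolding atLeast0LessThan by (intro sum.cong) (auto simp: pd ad)
  finally show "spectral_sum N c e $$ (k, l) = (P * ?D * mat_adjoint P) $$ (k, l)"
    using k l by (simp add: spectral_sum_def)
qed (auto simp: spectral_sum_def P_def mat_adjoint_def)

lemma spectral_sum_unique:
  assumes A: "spectral_decomposition N A E e" and A': "spectral_decomposition N A E' e'"
  shows "spectral_sum N (\<lambda>i. f (E i)) e = spectral_sum N (\<lambda>i. f (E' i)) e'"
proof -
  define P where "P e = mat N N (\<lambda>(k, i). e i $ k)" for e :: "nat \<Rightarrow> complex vec"
  define D where "D c = mat N N (\<lambda>(i, j). if i = j then c i else (0::complex))" for c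
  have P: "P e \<in> carrier_mat N N" for e unfolding P_def by auto
  have D: "D c \<in> carrier_mat N N" for c unfolding D_def by auto
  have adj: "mat_adjoint (P e) \<in> carrier_mat N N" for e
    unfolding mat_adjoint_def using P[of e] by auto
  have un: "mat_adjoint (P e) * P e = 1\<^sub>m N" if s: "spectral_decomposition N A E e" for E e
  proof (rule eq_matI)
    fix i j assume ij: "i < dim_row (1\<^sub>m N :: complex mat)" "j < dim_col (1\<^sub>m N :: complex mat)"
    hence i: "i < N" and j: "j < N" by auto
    have c: "e i \<in> carrier_vec N" "e j \<in> carrier_vec N"
      using s i j unfolding spectral_decomposition_def by auto
    have "(mat_adjoint (P e) * P e) $$ (i, j) = (\<Sum>k = 0..<N. cnj (e i $ k) * e j $ k)"
      using i j P[of e] adj[of e]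
      by (simp add: scalar_prod_def mat_adjoint_def mat_of_rows_index) (simp add: P_def)
    also have "\<dots> = e j \<bullet>c e i"
      using c by (simp add: scalar_prod_def mult.commute)
    finally show "(mat_adjoint (P e) * P e) $$ (i, j) = 1\<^sub>m N $$ (i, j)"
      using s i j unfolding spectral_decomposition_def by auto
  qed (use P adj in auto)
  have un': "P e * mat_adjoint (P e) = 1\<^sub>m N" if "spectral_decomposition N A E e" for E e
    by (rule mat_mult_left_right_inverse[OF adj P un[OF that]])
  have ss: "spectral_sum N c e = P e * D c * mat_adjoint (P e)"
    if "spectral_decomposition N A E e" for E e c
    unfolding P_def D_def
    by (rule spectral_sum_factor) (use that in \<open>auto simp: spectral_decomposition_def\<close>)
  let ?d = "\<lambda>i. complex_of_real (E i)" and ?d' = "\<lambda>i. complex_of_real (E' i)"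
  let ?Q = "mat_adjoint (P e)" and ?Q' = "mat_adjoint (P e')"
  define X where "X = ?Q * P e'"
  have X: "X \<in> carrier_mat N N" unfolding X_def by (rule mult_carrier_mat[OF adj P])
  note asc = assoc_mult_mat[of _ N N _ N _ N] mult_carrier_mat[of _ N N _ N] P D adj
  have canc: "mat_adjoint (P e) * (P e * Z) = Z" "P e * (mat_adjoint (P e) * Z) = Z"
    if "spectral_decomposition N A E e" "Z \<in> carrier_mat N N" for E e Z
    using un[OF that(1)] un'[OF that(1)] that(2) assoc_mult_mat[OF adj P that(2)]
      assoc_mult_mat[OF P adj that(2)] by (metis left_mult_one_mat)+
  note cA = canc[OF A] canc[OF A']
  have eqA: "P e * D ?d * ?Q = P e' * D ?d' * ?Q'"
    using ss[OF A] ss[OF A'] A A' unfolding spectral_decomposition_def by metis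
  have "D ?d * X = ?Q * P e * D ?d * ?Q * P e'"
    unfolding X_def by (simp add: cA asc)
  also have "\<dots> = ?Q * (P e * D ?d * ?Q) * P e'"
    by (simp add: asc)
  also have "\<dots> = ?Q * (P e' * D ?d' * ?Q') * P e'" by (simp only: eqA)
  also have "\<dots> = X * D ?d' * (?Q' * P e')"
    unfolding X_def by (simp add: asc)
  also have "\<dots> = X * D ?d'" by (simp add: asc X un[OF A'] right_mult_one_mat[OF D])
  finally have comm: "D ?d * X = X * D ?d'" .
  have left: "(D c * X) $$ (i, j) = c i * X $$ (i, j)" if "i < N" "j < N" for c i j
  proof -
    have "(D c * X) $$ (i, j) = (\<Sum>k = 0..<N. D c $$ (i, k) * X $$ (k, j))"
      using that X D[of c] by (simp add: scalar_prod_def)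
    also have "\<dots> = (\<Sum>k = 0..<N. if k = i then c i * X $$ (i, j) else 0)"
      using that by (intro sum.cong) (auto simp: D_def)
    finally show ?thesis using that by simp
  qed
  have right: "(X * D c) $$ (i, j) = X $$ (i, j) * c j" if "i < N" "j < N" for c i j
  proof -
    have "(X * D c) $$ (i, j) = (\<Sum>k = 0..<N. X $$ (i, k) * D c $$ (k, j))"
      using that X D[of c] by (simp add: scalar_prod_def)
    also have "\<dots> = (\<Sum>k = 0..<N. if k = j then X $$ (i, j) * c j else 0)"
      using that by (intro sum.cong) (auto simp: D_def)
    finally show ?thesis using that by simp
  qed
  let ?f = "\<lambda>i. f (E i)" and ?f' = "\<lambda>i. f (E' i)"
  have "D ?f * X = X * D ?f'"
  proof (rule eq_matI)
    fix i j assume "i < dim_row (X * D ?f')" "j < dim_col (X * D ?f')"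
    hence ij: "i < N" "j < N" using X D[of ?f] D[of ?f'] by auto
    have "?d i * X $$ (i, j) = X $$ (i, j) * ?d' j"
      using left[OF ij] right[OF ij] comm by metis
    hence "X $$ (i, j) = 0 \<or> E i = E' j" by (auto simp: mult.commute)
    thus "(D ?f * X) $$ (i, j) = (X * D ?f') $$ (i, j)"
      using left[OF ij] right[OF ij] by auto
  qed (use X D[of ?f] D[of ?f'] in auto)
  hence f: "D ?f * X = X * D ?f'" .
  have "P e * D ?f * ?Q = P e * D ?f * ?Q * (P e' * ?Q')"
    by (simp add: asc un'[OF A'] right_mult_one_mat[OF adj])
  also have "\<dots> = P e * (D ?f * X) * ?Q'"
    unfolding X_def by (simp add: asc)
  also have "\<dots> = P e * (X * D ?f') * ?Q'" by (simp only: f)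
  also have "\<dots> = (P e * ?Q) * P e' * D ?f' * ?Q'"
    unfolding X_def by (simp add: asc)
  also have "\<dots> = P e' * D ?f' * ?Q'"
    by (simp add: asc cA)
  finally show ?thesis using ss[OF A] ss[OF A'] by simp
qed

lemma op_fun_eq:
  assumes "spectral_decomposition N A E e"
  shows "op_fun f A = spectral_sum N (\<lambda>i. f (E i)) e"
proof -
  have N: "dim_row A = N"
    using assms unfolding spectral_decomposition_def spectral_sum_def by simp
  show ?thesis
    unfolding op_fun_def N
    by (rule the_equality) (use assms spectral_sum_unique in blast)+
qed

section \<open>Densities\<close>

definition prob_density :: "(real \<Rightarrow> real) \<Rightarrow> bool" where
  "prob_density f \<longleftrightarrow>
     f \<in> borel_measurable borel \<and> (\<forall>x. 0 \<le> f x) \<and> (\<integral>\<^sup>+x. ennreal (f x) \<partial>lborel) = 1"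

text \<open>The set where the density does not vanish, not its closure: the block-encoding hypothesis
  divides by the density at each point of its support.\<close>

definition supp :: "(real \<Rightarrow> real) \<Rightarrow> real set" where
  "supp f = {x. f x \<noteq> 0}"

text \<open>\<open>|<e i|\<psi>>|\<^sup>2\<close>; the product \<open>\<bullet>c\<close> conjugates its right argument.\<close>

definition spectral_weight :: "(nat \<Rightarrow> complex vec) \<Rightarrow> complex vec \<Rightarrow> nat \<Rightarrow> real" where
  "spectral_weight e \<psi> i = (cmod (\<psi> \<bullet>c e i))\<^sup>2"

text \<open>The density of \<open>p * \<nu>\<close>, where \<open>p\<close> has mass \<open>spectral_weight e \<psi> i\<close> at \<open>E i\<close>.
  Sign pitfall: the translates are \<open>\<nu> (x - E i)\<close>, the eigenvalues of \<open>\<nu> (xI - H)\<close>, whereas \<open>\<nu> (H - xI)\<close>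
  has eigenvalues \<open>\<nu> (E i - x)\<close>; the two agree when \<open>\<nu>\<close> is even.\<close>

definition spectral_conv ::
  "nat \<Rightarrow> (nat \<Rightarrow> real) \<Rightarrow> (nat \<Rightarrow> complex vec) \<Rightarrow> complex vec \<Rightarrow> (real \<Rightarrow> real) \<Rightarrow> real \<Rightarrow> real" where
  "spectral_conv n E e \<psi> \<nu> x = (\<Sum>i<2 ^ n. spectral_weight e \<psi> i * \<nu> (x - E i))"

section \<open>Sampling procedures\<close>

text \<open>Born rule for measuring the \<open>m\<close> ancillas of \<open>V |0^m>|\<psi>>\<close>: probability of outcome \<open>a\<close>.\<close>

definition ancilla_prob :: "nat \<Rightarrow> nat \<Rightarrow> complex vec \<Rightarrow> complex mat \<Rightarrow> nat \<Rightarrow> real" where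
  "ancilla_prob n m \<psi> V a =
     (l2_norm (ancilla_bra n m a *\<^sub>v (V *\<^sub>v (ancilla_ket n m 0 *\<^sub>v \<psi>))))\<^sup>2"

text \<open>One round: draw \<open>x\<close> with density \<open>\<mu>\<close>, apply \<open>U x\<close> to a fresh copy of \<open>|0^m>|\<psi>>\<close>, measure the
  ancillas. The classical record is \<open>x\<close> together with the flag telling whether all ancillas read
  \<open>0\<close>. Recording only this flag, rather than the whole bit string, makes the joint law well defined
  without requiring \<open>x \<mapsto> U x\<close> to be measurable.\<close>

definition round_measure ::
  "nat \<Rightarrow> nat \<Rightarrow> (real \<Rightarrow> real) \<Rightarrow> complex vec \<Rightarrow> (real \<Rightarrow> complex mat) \<Rightarrow> (real \<times> bool) measure" where
  "round_measure n m \<mu> \<psi> U = density (lborel \<Otimes>\<^sub>M count_space UNIV)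
     (\<lambda>(x, zero). ennreal (\<mu> x *
        (if zero then ancilla_prob n m \<psi> (U x) 0
         else (\<Sum>a\<in>{1..<2 ^ m}. ancilla_prob n m \<psi> (U x) a))))"

definition rounds_measure ::
  "nat \<Rightarrow> nat \<Rightarrow> (real \<Rightarrow> real) \<Rightarrow> complex vec \<Rightarrow> (real \<Rightarrow> complex mat) \<Rightarrow> (nat \<Rightarrow> real \<times> bool) measure" where
  "rounds_measure n m \<mu> \<psi> U = (\<Pi>\<^sub>M k\<in>UNIV. round_measure n m \<mu> \<psi> U)"

text \<open>A procedure decides from the record of the rounds made so far: \<open>None\<close> means to make another
  round, \<open>Some y\<close> means to stop and output \<open>y\<close>. It has no other access to \<open>H\<close>, \<open>\<psi>\<close> or \<open>U\<close>.\<close>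

type_synonym procedure = "(real \<times> bool) list \<Rightarrow> real option"

definition transcript :: "(nat \<Rightarrow> real \<times> bool) \<Rightarrow> nat \<Rightarrow> (real \<times> bool) list" where
  "transcript \<omega> k = map \<omega> [0..<k]"

definition halts :: "procedure \<Rightarrow> (nat \<Rightarrow> real \<times> bool) \<Rightarrow> bool" where
  "halts proc \<omega> \<longleftrightarrow> (\<exists>k. proc (transcript \<omega> k) \<noteq> None)"

definition halting_round :: "procedure \<Rightarrow> (nat \<Rightarrow> real \<times> bool) \<Rightarrow> nat" where
  "halting_round proc \<omega> = (LEAST k. proc (transcript \<omega> k) \<noteq> None)"

text \<open>Each round uses one \<open>U x\<close> exactly once.\<close>

definition num_uses :: "procedure \<Rightarrow> (nat \<Rightarrow> real \<times> bool) \<Rightarrow> ennreal" where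
  "num_uses proc \<omega> = (if halts proc \<omega> then of_nat (halting_round proc \<omega>) else \<infinity>)"

definition sample_output :: "procedure \<Rightarrow> (nat \<Rightarrow> real \<times> bool) \<Rightarrow> real" where
  "sample_output proc \<omega> = (if halts proc \<omega> then the (proc (transcript \<omega> (halting_round proc \<omega>))) else 0)"

text \<open>\<open>proc\<close>, run with samples from \<open>\<mu>\<close>, copies of \<open>\<psi>\<close> and access to \<open>U\<close>, halts almost surely with
  an output of density \<open>g\<close>, after an expected number \<open>c\<close> of uses of the unitaries.\<close>

definition generates_sample ::
  "procedure \<Rightarrow> nat \<Rightarrow> nat \<Rightarrow> (real \<Rightarrow> real) \<Rightarrow> complex vec \<Rightarrow> (real \<Rightarrow> complex mat) \<Rightarrow>
   (real \<Rightarrow> real) \<Rightarrow> real \<Rightarrow> bool" where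
  "generates_sample proc n m \<mu> \<psi> U g c \<longleftrightarrow>
     (let R = rounds_measure n m \<mu> \<psi> U in
        prob_space R \<and>
        (AE \<omega> in R. halts proc \<omega>) \<and>
        distributed R lborel (sample_output proc) (\<lambda>x. ennreal (g x)) \<and>
        num_uses proc \<in> borel_measurable R \<and>
        (\<integral>\<^sup>+\<omega>. num_uses proc \<omega> \<partial>R) = ennreal c)"

end

theory Submission
  imports Defs
begin

text \<open>The procedure is rejection sampling: repeat rounds until all ancillas read \<open>0\<close>, then output the
  sample \<open>x\<close> of that round. Since the block-encoding is exact, the acceptance probability given \<open>x\<close>
  is \<open>\<parallel>h(H - xI)\<psi>\<parallel>\<^sup>2 = \<langle>\<psi>| |h(H - xI)|\<^sup>2 |\<psi>\<rangle> = (p * \<nu>)(x) / (|M|\<^sup>2 \<mu>(x))\<close>, so the joint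
  density of \<open>x\<close> and acceptance is \<open>(p * \<nu>)(x) / |M|\<^sup>2\<close>, also where \<open>\<mu>\<close> vanishes, by the support
  condition. Hence each round succeeds with probability \<open>q = 1 / |M|\<^sup>2\<close>, an accepted sample has
  density \<open>p * \<nu>\<close>, and the number of rounds is geometric with mean \<open>1 / q\<close>, the sum over \<open>k\<close> of
  the probability \<open>(1 - q)\<^sup>k\<close> that the first \<open>k\<close> rounds fail.\<close>

section \<open>Norms and quadratic forms\<close>

lemma l2_norm_sq: "(l2_norm v)\<^sup>2 = (\<Sum>i<dim_vec v. (cmod (v $ i))\<^sup>2)"
  by (simp add: l2_norm_def sum_nonneg)

lemma l2_norm_eq_L2_set: "l2_norm v = L2_set (\<lambda>i. cmod (v $ i)) {..<dim_vec v}"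
  by (simp add: l2_norm_def L2_set_def)

lemma mult_mat_vec_index:
  assumes "i < dim_row A" "dim_vec v = dim_col A"
  shows "(A *\<^sub>v v) $ i = (\<Sum>j<dim_col A. A $$ (i, j) * v $ j)"
  using assms by (simp add: scalar_prod_def lessThan_atLeast0)

lemma mat_adjoint_index:
  assumes "i < dim_col A" "j < dim_row A"
  shows "mat_adjoint A $$ (i, j) = cnj (A $$ (j, i))"
  using assms by (simp add: mat_adjoint_def mat_of_rows_index)

lemma mat_adjoint_dim [simp]: "dim_row (mat_adjoint A) = dim_col A" "dim_col (mat_adjoint A) = dim_row A"
  by (simp_all add: mat_adjoint_def)

text \<open>A crude bound, but independent of \<open>v\<close>: it shows that the set under the
  \<open>Sup\<close> in \<open>op_norm\<close> is bounded above, without which a real supremum says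
  nothing.\<close>

lemma l2_norm_mult_vec_le:
  assumes "l2_norm v = 1" "dim_vec v = dim_col A"
  shows "l2_norm (A *\<^sub>v v) \<le> (\<Sum>i<dim_row A. \<Sum>j<dim_col A. cmod (A $$ (i, j)))"
proof -
  have v: "cmod (v $ j) \<le> 1" if "j < dim_col A" for j
    using member_le_L2_set[of "{..<dim_vec v}" j "\<lambda>i. cmod (v $ i)"] assms that
    by (simp add: l2_norm_eq_L2_set)
  have "l2_norm (A *\<^sub>v v) \<le> (\<Sum>i<dim_row A. cmod ((A *\<^sub>v v) $ i))"
    unfolding l2_norm_eq_L2_set dim_mult_mat_vec by (rule L2_set_le_sum) simp
  also have "\<dots> \<le> (\<Sum>i<dim_row A. \<Sum>j<dim_col A. cmod (A $$ (i, j)))"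
  proof (rule sum_mono)
    fix i assume i: "i \<in> {..<dim_row A}"
    have "cmod ((A *\<^sub>v v) $ i) \<le> (\<Sum>j<dim_col A. cmod (A $$ (i, j)) * cmod (v $ j))"
      using i assms norm_sum[of "\<lambda>j. A $$ (i, j) * v $ j" "{..<dim_col A}"]
      by (simp add: mult_mat_vec_index norm_mult del: index_mult_mat_vec)
    also have "\<dots> \<le> (\<Sum>j<dim_col A. cmod (A $$ (i, j)))"
      by (rule sum_mono) (use v in \<open>auto intro: mult_left_le\<close>)
    finally show "cmod ((A *\<^sub>v v) $ i) \<le> (\<Sum>j<dim_col A. cmod (A $$ (i, j)))" .
  qed
  finally show ?thesis .
qed

lemma l2_norm_mult_vec_le_op_norm:
  assumes "l2_norm v = 1" "dim_vec v = dim_col A"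
  shows "l2_norm (A *\<^sub>v v) \<le> op_norm A"
  unfolding op_norm_def
proof (rule cSup_upper)
  show "l2_norm (A *\<^sub>v v) \<in> {l2_norm (A *\<^sub>v v) |v. v \<in> carrier_vec (dim_col A) \<and> l2_norm v = 1}"
    using assms carrier_vecI[OF assms(2)] by blast
  show "bdd_above {l2_norm (A *\<^sub>v v) |v. v \<in> carrier_vec (dim_col A) \<and> l2_norm v = 1}"
  proof (rule bdd_aboveI)
    fix x assume "x \<in> {l2_norm (A *\<^sub>v v) |v. v \<in> carrier_vec (dim_col A) \<and> l2_norm v = 1}"
    then obtain v where "x = l2_norm (A *\<^sub>v v)" "v \<in> carrier_vec (dim_col A)" "l2_norm v = 1"
      by auto
    then show "x \<le> (\<Sum>i<dim_row A. \<Sum>j<dim_col A. cmod (A $$ (i, j)))"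
      using l2_norm_mult_vec_le[of v A] by simp
  qed
qed

text \<open>Applying \<open>A\<close> to a standard basis vector yields a column, so every entry is
  bounded by \<open>op_norm A\<close>. This turns a block-encoding with error 0 into an equation of
  matrices.\<close>

lemma op_norm_le_0:
  assumes "op_norm A \<le> 0"
  shows "A = 0\<^sub>m (dim_row A) (dim_col A)"
proof (rule eq_matI)
  fix i j
  assume "i < dim_row (0\<^sub>m (dim_row A) (dim_col A) :: complex mat)"
    and "j < dim_col (0\<^sub>m (dim_row A) (dim_col A) :: complex mat)"
  then have i: "i < dim_row A" and j: "j < dim_col A" by auto
  let ?u = "unit_vec (dim_col A) j :: complex vec"
  have "(\<Sum>i<dim_col A. (cmod (?u $ i))\<^sup>2) = (\<Sum>i<dim_col A. if i = j then 1 else 0)"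
    using j by (intro sum.cong) auto
  then have u: "l2_norm ?u = 1"
    using j by (simp add: l2_norm_def)
  have "l2_norm (A *\<^sub>v ?u) \<le> 0"
    using l2_norm_mult_vec_le_op_norm[OF u, of A] assms by simp
  moreover have "cmod ((A *\<^sub>v ?u) $ i) \<le> l2_norm (A *\<^sub>v ?u)"
    unfolding l2_norm_eq_L2_set dim_mult_mat_vec by (rule member_le_L2_set) (use i in auto)
  ultimately have "cmod ((A *\<^sub>v ?u) $ i) \<le> 0" by linarith
  then have "(A *\<^sub>v ?u) $ i = 0" by (simp only: norm_le_zero_iff)
  then show "A $$ (i, j) = 0\<^sub>m (dim_row A) (dim_col A) $$ (i, j)"
    using i j by simp
qed auto

section \<open>Quadratic forms, Parseval and functional calculus\<close>

text \<open>Expanding the inner product of \<open>A v\<close> with itself leaves only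
  \<open>abs_sq A\<close>. Hence a hypothesis on the squared modulus of h(H - xI) alone fixes the
  acceptance probability, whatever the phases of h.\<close>

lemma l2_norm_mult_vec_sq:
  assumes "dim_vec v = dim_col A"
  shows "complex_of_real ((l2_norm (A *\<^sub>v v))\<^sup>2) =
    (\<Sum>k<dim_col A. \<Sum>l<dim_col A. cnj (v $ k) * abs_sq A $$ (k, l) * v $ l)"
proof -
  let ?N = "{..<dim_col A}"
  have sq: "abs_sq A $$ (k, l) = (\<Sum>r<dim_row A. cnj (A $$ (r, k)) * A $$ (r, l))"
    if "k < dim_col A" "l < dim_col A" for k l
    unfolding abs_sq_def using that
    by (auto simp: scalar_prod_def mat_adjoint_index lessThan_atLeast0 intro: sum.cong)
  have "complex_of_real ((l2_norm (A *\<^sub>v v))\<^sup>2) =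
      (\<Sum>r<dim_row A. cnj ((A *\<^sub>v v) $ r) * (A *\<^sub>v v) $ r)"
    by (simp only: l2_norm_sq of_real_sum complex_norm_square dim_mult_mat_vec mult.commute)
  also have "\<dots> = (\<Sum>r<dim_row A. \<Sum>k\<in>?N. \<Sum>l\<in>?N. cnj (v $ k) * (cnj (A $$ (r, k)) * A $$ (r, l)) * v $ l)"
  proof (rule sum.cong[OF refl])
    fix r assume "r \<in> {..<dim_row A}"
    then have "cnj ((A *\<^sub>v v) $ r) * (A *\<^sub>v v) $ r =
        (\<Sum>k\<in>?N. cnj (A $$ (r, k)) * cnj (v $ k)) * (\<Sum>l\<in>?N. A $$ (r, l) * v $ l)"
      using assms by (simp add: mult_mat_vec_index del: index_mult_mat_vec)
    also have "\<dots> = (\<Sum>k\<in>?N. \<Sum>l\<in>?N. cnj (v $ k) * (cnj (A $$ (r, k)) * A $$ (r, l)) * v $ l)"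
      unfolding sum_product by (intro sum.cong refl) (simp add: mult_ac)
    finally show "cnj ((A *\<^sub>v v) $ r) * (A *\<^sub>v v) $ r =
        (\<Sum>k\<in>?N. \<Sum>l\<in>?N. cnj (v $ k) * (cnj (A $$ (r, k)) * A $$ (r, l)) * v $ l)" .
  qed
  also have "\<dots> = (\<Sum>k\<in>?N. \<Sum>l\<in>?N. \<Sum>r<dim_row A. cnj (v $ k) * (cnj (A $$ (r, k)) * A $$ (r, l)) * v $ l)"
    \<comment> \<open>Two exchanges move the row index \<open>r\<close> innermost, where the sum
      over it is an entry of \<open>abs_sq A\<close>.\<close>
    by (subst sum.swap, rule sum.cong[OF refl], rule sum.swap)
  also have "\<dots> = (\<Sum>k\<in>?N. \<Sum>l\<in>?N. cnj (v $ k) * abs_sq A $$ (k, l) * v $ l)"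
    by (intro sum.cong refl) (simp add: sq sum_distrib_left sum_distrib_right)
  finally show ?thesis .
qed

lemma abs_sq_unitary: "unitary_mat N U \<Longrightarrow> abs_sq U = 1\<^sub>m N"
  by (simp add: abs_sq_def unitary_mat_def)

lemma quadratic_form_one_mat:
  assumes "dim_vec v = N"
  shows "(\<Sum>k<N. \<Sum>l<N. cnj (v $ k) * (1\<^sub>m N $$ (k, l)) * v $ l) = complex_of_real ((l2_norm v)\<^sup>2)"
proof -
  have "(\<Sum>l<N. cnj (v $ k) * (1\<^sub>m N $$ (k, l)) * v $ l) = cnj (v $ k) * v $ k" if "k < N" for k
  proof -
    have "(\<Sum>l<N. cnj (v $ k) * (1\<^sub>m N $$ (k, l)) * v $ l) =
        (\<Sum>l<N. if k = l then cnj (v $ k) * v $ k else 0)"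
      using that by (intro sum.cong) auto
    then show ?thesis using that by simp
  qed
  then show ?thesis
    using assms by (simp only: l2_norm_sq of_real_sum complex_norm_square) (simp add: mult.commute)
qed

lemma l2_norm_unitary:
  assumes "unitary_mat N U" "dim_vec v = N"
  shows "l2_norm (U *\<^sub>v v) = l2_norm v"
proof -
  have d: "dim_col U = N" using assms(1) by (auto simp: unitary_mat_def)
  have "complex_of_real ((l2_norm (U *\<^sub>v v))\<^sup>2) = complex_of_real ((l2_norm v)\<^sup>2)"
    using l2_norm_mult_vec_sq[of v U] assms quadratic_form_one_mat[of v N] by (simp add: d abs_sq_unitary)
  then have "(l2_norm (U *\<^sub>v v))\<^sup>2 = (l2_norm v)\<^sup>2" by (simp only: of_real_eq_iff)
  then show ?thesis
    by (rule power2_eq_imp_eq) (simp_all add: l2_norm_def sum_nonneg)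
qed

text \<open>The quadratic form of each projector |e i><e i| factors into an overlap times its
  conjugate, which is \<open>spectral_weight e v i\<close>.\<close>

lemma quadratic_form_spectral_sum:
  assumes "dim_vec v = N" and e: "\<And>i. i < N \<Longrightarrow> e i \<in> carrier_vec N"
  shows "(\<Sum>k<N. \<Sum>l<N. cnj (v $ k) * spectral_sum N c e $$ (k, l) * v $ l) =
    (\<Sum>i<N. c i * complex_of_real (spectral_weight e v i))"
proof -
  have w: "complex_of_real (spectral_weight e v i) =
      (\<Sum>k<N. \<Sum>l<N. cnj (v $ k) * e i $ k * cnj (e i $ l) * v $ l)" if "i < N" for i
  proof -
    have "v \<bullet>c e i = (\<Sum>l<N. v $ l * cnj (e i $ l))"
      using e[OF that] by (auto simp: scalar_prod_def lessThan_atLeast0 intro: sum.cong)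
    then have "complex_of_real (spectral_weight e v i) =
        (\<Sum>k<N. cnj (v $ k) * e i $ k) * (\<Sum>l<N. v $ l * cnj (e i $ l))"
      unfolding spectral_weight_def complex_norm_square by (simp add: mult.commute)
    also have "\<dots> = (\<Sum>k<N. \<Sum>l<N. cnj (v $ k) * e i $ k * cnj (e i $ l) * v $ l)"
      unfolding sum_product by (intro sum.cong refl) (simp add: mult_ac)
    finally show ?thesis .
  qed
  have "(\<Sum>k<N. \<Sum>l<N. cnj (v $ k) * spectral_sum N c e $$ (k, l) * v $ l) =
      (\<Sum>k<N. \<Sum>l<N. \<Sum>i<N. c i * (cnj (v $ k) * e i $ k * cnj (e i $ l) * v $ l))"
    by (intro sum.cong refl)
      (simp add: spectral_sum_def sum_distrib_left sum_distrib_right mult_ac)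
  also have "\<dots> = (\<Sum>k<N. \<Sum>i<N. \<Sum>l<N. c i * (cnj (v $ k) * e i $ k * cnj (e i $ l) * v $ l))"
    by (rule sum.cong[OF refl], rule sum.swap)
  also have "\<dots> = (\<Sum>i<N. \<Sum>k<N. \<Sum>l<N. c i * (cnj (v $ k) * e i $ k * cnj (e i $ l) * v $ l))"
    by (rule sum.swap)
  also have "\<dots> = (\<Sum>i<N. c i * complex_of_real (spectral_weight e v i))"
    by (intro sum.cong refl) (simp add: w sum_distrib_left)
  finally show ?thesis .
qed

text \<open>Completeness of the eigenbasis: orthonormality says that the matrix of eigenvectors has
  its adjoint as left inverse, and for square matrices this is also a right inverse.\<close>

lemma spectral_sum_one:
  assumes "spectral_decomposition N A E e"
  shows "spectral_sum N (\<lambda>_. 1) e = 1\<^sub>m N"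
proof -
  let ?P = "mat N N (\<lambda>(k, i). e i $ k)"
  have e: "e i \<in> carrier_vec N" if "i < N" for i
    using assms that by (simp add: spectral_decomposition_def)
  have left: "mat_adjoint ?P * ?P = 1\<^sub>m N"
  proof (rule eq_matI)
    fix i j
    assume "i < dim_row (1\<^sub>m N :: complex mat)" "j < dim_col (1\<^sub>m N :: complex mat)"
    then have ij: "i < N" "j < N" by auto
    have "(mat_adjoint ?P * ?P) $$ (i, j) = e j \<bullet>c e i"
      using ij e[OF ij(1)] e[OF ij(2)]
      by (auto simp: scalar_prod_def mat_adjoint_index mult.commute intro: sum.cong)
    moreover have "e j \<bullet>c e i = (if j = i then 1 else 0)"
      using assms ij unfolding spectral_decomposition_def by blast
    ultimately show "(mat_adjoint ?P * ?P) $$ (i, j) = 1\<^sub>m N $$ (i, j)"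
      using ij by simp
  qed auto
  have P: "?P \<in> carrier_mat N N" and adj: "mat_adjoint ?P \<in> carrier_mat N N"
    by (rule carrier_matI; simp)+
  have one: "mat N N (\<lambda>(i, j). if i = j then 1 else 0) = (1\<^sub>m N :: complex mat)"
    by (rule eq_matI) auto
  have "spectral_sum N (\<lambda>_. 1) e =
      ?P * mat N N (\<lambda>(i, j). if i = j then 1 else 0) * mat_adjoint ?P"
    by (rule spectral_sum_factor) (use e in blast)
  also have "\<dots> = ?P * mat_adjoint ?P"
    by (simp only: one right_mult_one_mat[OF P])
  also have "\<dots> = 1\<^sub>m N"
    by (rule mat_mult_left_right_inverse[OF adj P left])
  finally show ?thesis .
qed

text \<open>Parseval, obtained by evaluating the quadratic form of the identity in two ways. For a
  unit vector it says that p has total mass 1.\<close>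

lemma sum_spectral_weight:
  assumes "spectral_decomposition N A E e" "dim_vec v = N"
  shows "(\<Sum>i<N. spectral_weight e v i) = (l2_norm v)\<^sup>2"
proof -
  have "complex_of_real (\<Sum>i<N. spectral_weight e v i) = complex_of_real ((l2_norm v)\<^sup>2)"
    using quadratic_form_spectral_sum[of v N e "\<lambda>_. 1"] quadratic_form_one_mat[of v N] spectral_sum_one[OF assms(1)] assms
    by (simp add: spectral_decomposition_def)
  then show ?thesis by (simp only: of_real_eq_iff)
qed

text \<open>Serves for both H - xI and xI - H, which share the eigenvectors of H.\<close>

lemma spectral_decomposition_affine:
  assumes "spectral_decomposition N A E e"
  shows "spectral_decomposition N
    (complex_of_real a \<cdot>\<^sub>m A + complex_of_real b \<cdot>\<^sub>m 1\<^sub>m N) (\<lambda>i. a * E i + b) e"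
proof -
  have A: "A = spectral_sum N (\<lambda>i. complex_of_real (E i)) e"
    using assms by (simp add: spectral_decomposition_def)
  have "complex_of_real a \<cdot>\<^sub>m A + complex_of_real b \<cdot>\<^sub>m spectral_sum N (\<lambda>_. 1) e =
      spectral_sum N (\<lambda>i. complex_of_real (a * E i + b)) e"
    unfolding A
    by (rule eq_matI) (simp_all add: spectral_sum_def sum_distrib_left sum.distrib distrib_right mult.assoc)
  then show ?thesis
    using assms spectral_sum_one[OF assms] by (simp add: spectral_decomposition_def)
qed

lemma l2_norm_abs_sq_op_fun:
  assumes "spectral_decomposition N B F e" and B: "B' \<in> carrier_mat N N" and v: "dim_vec v = N"
    and sq: "abs_sq B' = complex_of_real c \<cdot>\<^sub>m op_fun (\<lambda>y. complex_of_real (f y)) B"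
  shows "(l2_norm (B' *\<^sub>v v))\<^sup>2 = c * (\<Sum>i<N. spectral_weight e v i * f (F i))"
proof -
  have e: "e i \<in> carrier_vec N" if "i < N" for i
    using assms that by (simp add: spectral_decomposition_def)
  have "complex_of_real ((l2_norm (B' *\<^sub>v v))\<^sup>2) =
      (\<Sum>k<N. \<Sum>l<N. complex_of_real c * (cnj (v $ k) * spectral_sum N (\<lambda>i. complex_of_real (f (F i))) e $$ (k, l) * v $ l))"
    using l2_norm_mult_vec_sq[of v B'] B v
    by (simp add: sq op_fun_eq[OF assms(1)] spectral_sum_def mult_ac)
  also have "\<dots> = complex_of_real c * (\<Sum>i<N. complex_of_real (f (F i)) * complex_of_real (spectral_weight e v i))"
    by (simp add: sum_distrib_left[symmetric] quadratic_form_spectral_sum[OF v e])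
  also have "\<dots> = complex_of_real (c * (\<Sum>i<N. spectral_weight e v i * f (F i)))"
    by (simp add: mult.commute)
  finally show ?thesis by (simp only: of_real_eq_iff)
qed

section \<open>Ancilla measurements and block-encodings\<close>

lemma ancilla_ket_carrier: "ancilla_ket n m a \<in> carrier_mat (2 ^ (n + m)) (2 ^ n)"
  by (rule carrier_matI) (auto simp: ancilla_ket_def kron_def ket_def power_add)

lemma ancilla_bra_carrier: "ancilla_bra n m a \<in> carrier_mat (2 ^ n) (2 ^ (n + m))"
  by (rule carrier_matI) (auto simp: ancilla_bra_def kron_def ket_def power_add)

lemma block_index_less:
  fixes a i :: nat
  assumes "a < 2 ^ m" "i < 2 ^ n"
  shows "a * 2 ^ n + i < 2 ^ (n + m)"
proof -
  have "a * 2 ^ n + i < Suc a * 2 ^ n" using assms by simp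
  also have "\<dots> \<le> 2 ^ m * 2 ^ n" using assms by (intro mult_le_mono1) simp
  finally show ?thesis by (simp add: power_add mult.commute)
qed

text \<open>With the ancilla as left factor, position \<open>a * 2 ^ n + i\<close> belongs to
  ancilla value \<open>a\<close> and system index \<open>i\<close>, so <a| \<otimes> I cuts out the
  \<open>a\<close>-th block.\<close>

lemma ancilla_bra_mult_vec:
  assumes w: "dim_vec w = 2 ^ (n + m)" and a: "a < 2 ^ m" and i: "i < 2 ^ n"
  shows "(ancilla_bra n m a *\<^sub>v w) $ i = w $ (a * 2 ^ n + i)"
proof -
  have entry: "ancilla_bra n m a $$ (i, j) = (if j = a * 2 ^ n + i then 1 else 0)"
    if "j < 2 ^ (n + m)" for j
  proof -
    have "j div 2 ^ n < 2 ^ m" "j < 2 ^ m * 2 ^ n"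
      using that by (simp_all add: power_add less_mult_imp_div_less mult.commute)
    moreover have "j = a * 2 ^ n + i \<longleftrightarrow> j div 2 ^ n = a \<and> i = j mod 2 ^ n"
      using i by (auto simp: div_mult_mod_eq)
    ultimately show ?thesis
      using i by (auto simp: ancilla_bra_def kron_def ket_def mat_adjoint_index)
  qed
  have "(ancilla_bra n m a *\<^sub>v w) $ i = (\<Sum>j<2 ^ (n + m). ancilla_bra n m a $$ (i, j) * w $ j)"
    using mult_mat_vec_index[of i "ancilla_bra n m a" w] ancilla_bra_carrier[of n m a] w i by simp
  also have "\<dots> = (\<Sum>j<2 ^ (n + m). if j = a * 2 ^ n + i then w $ j else 0)"
    by (intro sum.cong) (auto simp: entry)
  finally show ?thesis using block_index_less[OF a i] by simp
qed

lemma ancilla_ket_0_mult_vec: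
  assumes v: "dim_vec v = 2 ^ n" and a: "a < 2 ^ m" and i: "i < 2 ^ n"
  shows "(ancilla_ket n m 0 *\<^sub>v v) $ (a * 2 ^ n + i) = (if a = 0 then v $ i else 0)"
proof -
  note less = block_index_less[OF a i]
  have entry: "ancilla_ket n m 0 $$ (a * 2 ^ n + i, j) = (if i = j \<and> a = 0 then 1 else 0)"
    if "j < 2 ^ n" for j
    using that less i a by (auto simp: ancilla_ket_def kron_def ket_def power_add mult.commute)
  have "(ancilla_ket n m 0 *\<^sub>v v) $ (a * 2 ^ n + i) =
      (\<Sum>j<2 ^ n. ancilla_ket n m 0 $$ (a * 2 ^ n + i, j) * v $ j)"
    using mult_mat_vec_index[of "a * 2 ^ n + i" "ancilla_ket n m 0" v] ancilla_ket_carrier[of n m 0] v less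
    by simp
  also have "\<dots> = (\<Sum>j<2 ^ n. if i = j then (if a = 0 then v $ i else 0) else 0)"
    by (intro sum.cong) (auto simp: entry)
  finally show ?thesis using i by simp
qed

text \<open>The blocks partition the index range, so their squared norms add up.\<close>

lemma sum_l2_norm_ancilla_bra:
  assumes w: "dim_vec w = 2 ^ (n + m)"
  shows "(\<Sum>a<2 ^ m. (l2_norm (ancilla_bra n m a *\<^sub>v w))\<^sup>2) = (l2_norm w)\<^sup>2"
proof -
  have "(l2_norm (ancilla_bra n m a *\<^sub>v w))\<^sup>2 = (\<Sum>j = a * 2 ^ n..<a * 2 ^ n + 2 ^ n. (cmod (w $ j))\<^sup>2)"
    if a: "a < 2 ^ m" for a
  proof -
    have "(l2_norm (ancilla_bra n m a *\<^sub>v w))\<^sup>2 = (\<Sum>i<2 ^ n. (cmod (w $ (a * 2 ^ n + i)))\<^sup>2)"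
      using ancilla_bra_carrier[of n m a]
      by (simp add: l2_norm_sq ancilla_bra_mult_vec[OF w a] del: index_mult_mat_vec)
    then show ?thesis
      using sum.shift_bounds_nat_ivl[of "\<lambda>j. (cmod (w $ j))\<^sup>2" 0 "a * 2 ^ n" "2 ^ n"]
      by (simp add: lessThan_atLeast0 add.commute)
  qed
  then have "(\<Sum>a<2 ^ m. (l2_norm (ancilla_bra n m a *\<^sub>v w))\<^sup>2) =
      (\<Sum>a<2 ^ m. \<Sum>j = a * 2 ^ n..<a * 2 ^ n + 2 ^ n. (cmod (w $ j))\<^sup>2)"
    by simp
  also have "\<dots> = (l2_norm w)\<^sup>2"
    by (simp add: sum.nat_group l2_norm_sq w power_add mult.commute)
  finally show ?thesis .
qed

text \<open>Block 0 of the image is \<open>v\<close> and all other blocks vanish.\<close>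

lemma l2_norm_ancilla_ket_0:
  assumes v: "dim_vec v = 2 ^ n"
  shows "l2_norm (ancilla_ket n m 0 *\<^sub>v v) = l2_norm v"
proof -
  let ?w = "ancilla_ket n m 0 *\<^sub>v v"
  have w: "dim_vec ?w = 2 ^ (n + m)" using ancilla_ket_carrier[of n m 0] by simp
  have "(l2_norm (ancilla_bra n m a *\<^sub>v ?w))\<^sup>2 = (if a = 0 then (l2_norm v)\<^sup>2 else 0)"
    if a: "a < 2 ^ m" for a
    using ancilla_bra_carrier[of n m a] v
    by (simp add: l2_norm_sq ancilla_bra_mult_vec[OF w a] ancilla_ket_0_mult_vec[OF v a] del: index_mult_mat_vec)
  then have "(l2_norm ?w)\<^sup>2 = (l2_norm v)\<^sup>2"
    using sum_l2_norm_ancilla_bra[OF w] by simp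
  then show ?thesis
    by (rule power2_eq_imp_eq) (simp_all add: l2_norm_def sum_nonneg)
qed

lemma sum_ancilla_prob:
  assumes "unitary_mat (2 ^ (n + m)) V" "qubit_state n \<psi>"
  shows "(\<Sum>a<2 ^ m. ancilla_prob n m \<psi> V a) = 1"
proof -
  have "V \<in> carrier_mat (2 ^ (n + m)) (2 ^ (n + m))"
    using assms(1) by (simp add: unitary_mat_def)
  moreover have "dim_vec (ancilla_ket n m 0 *\<^sub>v \<psi>) = 2 ^ (n + m)"
    using ancilla_ket_carrier[of n m 0] by simp
  ultimately show ?thesis
    using assms l2_norm_ancilla_ket_0[of \<psi> n m]
    by (simp add: ancilla_prob_def sum_l2_norm_ancilla_bra l2_norm_unitary qubit_state_def)
qed

lemma block_encoding_exact:
  assumes "block_encoding n 1 m 0 A V"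
  shows "ancilla_bra n m 0 * V * ancilla_ket n m 0 = A"
proof -
  let ?B = "ancilla_bra n m 0 * V * ancilla_ket n m 0"
  have A: "A \<in> carrier_mat (2 ^ n) (2 ^ n)" and "op_norm (A - 1 \<cdot>\<^sub>m ?B) \<le> 0"
    using assms by (auto simp: block_encoding_def)
  moreover have B: "?B \<in> carrier_mat (2 ^ n) (2 ^ n)"
    using ancilla_bra_carrier[of n m 0] ancilla_ket_carrier[of n m 0] by (intro carrier_matI) auto
  moreover have "1 \<cdot>\<^sub>m ?B = ?B" by (rule eq_matI) auto
  ultimately have z: "A - ?B = 0\<^sub>m (2 ^ n) (2 ^ n)"
    using op_norm_le_0[of "A - ?B"] minus_carrier_mat[OF B, of A] by (simp only: carrier_matD)
  show ?thesis
  proof (rule eq_matI)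
    fix i j assume "i < dim_row A" "j < dim_col A"
    then have "i < 2 ^ n" "j < 2 ^ n" using A by auto
    then have "(A - ?B) $$ (i, j) = 0" "(A - ?B) $$ (i, j) = A $$ (i, j) - ?B $$ (i, j)"
      using B by (simp add: z) (rule index_minus_mat, use B \<open>i < 2 ^ n\<close> \<open>j < 2 ^ n\<close> in auto)
    then show "?B $$ (i, j) = A $$ (i, j)" by simp
  qed (use A B in auto)
qed

lemma ancilla_prob_block_encoding:
  assumes "block_encoding n 1 m 0 A V" "dim_vec \<psi> = 2 ^ n"
  shows "ancilla_prob n m \<psi> V 0 = (l2_norm (A *\<^sub>v \<psi>))\<^sup>2"
proof -
  have V: "V \<in> carrier_mat (2 ^ (n + m)) (2 ^ (n + m))"
    using assms(1) unfolding block_encoding_def unitary_mat_def by blast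
  have \<psi>: "\<psi> \<in> carrier_vec (2 ^ n)" by (rule carrier_vecI) fact
  note bra = ancilla_bra_carrier[of n m 0] and ket = ancilla_ket_carrier[of n m 0]
  have "ancilla_bra n m 0 * V * ancilla_ket n m 0 *\<^sub>v \<psi> =
      ancilla_bra n m 0 *\<^sub>v (V *\<^sub>v (ancilla_ket n m 0 *\<^sub>v \<psi>))"
    using assoc_mult_mat_vec[OF mult_carrier_mat[OF bra V] ket \<psi>]
      assoc_mult_mat_vec[OF bra V mult_mat_vec_carrier[OF ket \<psi>]] by (simp only:)
  then show ?thesis
    unfolding ancilla_prob_def block_encoding_exact[OF assms(1)] by (simp only:)
qed

section \<open>Rejection sampling\<close>

text \<open>Inspecting the last round is enough: the run stops at the shortest transcript with an
  answer, so all earlier rounds have failed. The guard is there because \<open>last []\<close> is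
  unspecified.\<close>

definition first_success :: procedure where
  "first_success xs = (if xs \<noteq> [] \<and> snd (last xs) then Some (fst (last xs)) else None)"

lemma first_success_transcript:
  "first_success (transcript \<omega> 0) = None"
  "first_success (transcript \<omega> (Suc k)) = (if snd (\<omega> k) then Some (fst (\<omega> k)) else None)"
  by (simp_all add: first_success_def transcript_def)

lemma halts_first_success: "halts first_success \<omega> \<longleftrightarrow> (\<exists>k. snd (\<omega> k))"
proof
  assume "halts first_success \<omega>"
  then obtain k where "first_success (transcript \<omega> k) \<noteq> None" by (auto simp: halts_def)
  then show "\<exists>k. snd (\<omega> k)"
    by (cases k) (auto simp: first_success_transcript split: if_splits)
next
  assume "\<exists>k. snd (\<omega> k)"
  then obtain k where "snd (\<omega> k)" ..
  then have "first_success (transcript \<omega> (Suc k)) \<noteq> None"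
    by (simp add: first_success_transcript)
  then show "halts first_success \<omega>" unfolding halts_def ..
qed

text \<open>Rounds are indexed from 0, while the halting round is the length of the transcript;
  hence the \<open>Suc\<close>.\<close>

lemma halting_round_first_success:
  assumes "snd (\<omega> k)"
  shows "halting_round first_success \<omega> = Suc (LEAST k. snd (\<omega> k))"
proof -
  have "(LEAST k. first_success (transcript \<omega> k) \<noteq> None) =
      Suc (LEAST k. first_success (transcript \<omega> (Suc k)) \<noteq> None)"
    by (rule Least_Suc[of _ "Suc k"]) (simp_all add: first_success_transcript assms)
  then show ?thesis by (simp add: halting_round_def first_success_transcript)
qed

lemma sample_output_first_success:
  "sample_output first_success \<omega> =
    (if \<exists>k. snd (\<omega> k) then fst (\<omega> (LEAST k. snd (\<omega> k))) else 0)"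
proof (cases "\<exists>k. snd (\<omega> k)")
  case True
  then obtain k where k: "snd (\<omega> k)" ..
  then have "snd (\<omega> (LEAST k. snd (\<omega> k)))" by (rule LeastI)
  then show ?thesis
    using True by (simp add: sample_output_def halts_first_success halting_round_first_success[of \<omega>, OF k]
      first_success_transcript)
qed (simp add: sample_output_def halts_first_success)

text \<open>The tail-sum formula: a count is the sum over \<open>k\<close> of the indicators that it
  exceeds \<open>k\<close>. It also covers runs that never succeed, where all terms are 1 and the
  sum is infinite.\<close>

lemma num_uses_first_success:
  "num_uses first_success \<omega> = (\<Sum>k. indicator {\<omega>. \<forall>i<k. \<not> snd (\<omega> i)} \<omega>)"
proof (cases "\<exists>k. snd (\<omega> k)")
  case True
  define N where "N = (LEAST k. snd (\<omega> k))"
  have N: "snd (\<omega> N)" using True unfolding N_def by (rule LeastI_ex)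
  \<comment> \<open>The first \<open>k\<close> rounds all fail exactly for \<open>k\<close> from 0
    to \<open>N\<close>, which makes \<open>Suc N\<close> terms equal to 1.\<close>
  have "(\<forall>i<k. \<not> snd (\<omega> i)) \<longleftrightarrow> k < Suc N" for k
  proof
    assume "\<forall>i<k. \<not> snd (\<omega> i)"
    then have "\<not> N < k" using N by blast
    then show "k < Suc N" by simp
  next
    assume "k < Suc N"
    show "\<forall>i<k. \<not> snd (\<omega> i)"
    proof (intro allI impI)
      fix i assume "i < k"
      with \<open>k < Suc N\<close> have "i < (LEAST k. snd (\<omega> k))" unfolding N_def by linarith
      then show "\<not> snd (\<omega> i)" by (rule not_less_Least)
    qed
  qed
  then have "(\<Sum>k. indicator {\<omega>. \<forall>i<k. \<not> snd (\<omega> i)} \<omega>) = (\<Sum>k<Suc N. 1 :: ennreal)"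
    by (subst suminf_finite[of "{..<Suc N}"]) (auto simp: indicator_def)
  then show ?thesis
    using True by (simp add: num_uses_def halts_first_success halting_round_first_success[of \<omega>, OF N] flip: N_def)
next
  case False
  then have "(\<Sum>k. indicator {\<omega>. \<forall>i<k. \<not> snd (\<omega> i)} \<omega>) = (\<Sum>k. 1 :: ennreal)"
    by (simp add: indicator_def)
  also have "\<dots> = \<infinity>"
    by (simp add: suminf_eq_SUP ennreal_SUP_of_nat_eq_top)
  finally show ?thesis using False by (simp add: num_uses_def halts_first_success)
qed

section \<open>The geometric law of the first success in independent rounds\<close>

lemma suminf_geometric_ennreal:
  assumes "0 < q" "q \<le> 1"
  shows "(\<Sum>k. ennreal (1 - q) ^ k) = ennreal (1 / q)"
proof -
  have "(\<lambda>k. (1 - q) ^ k) sums (1 / q)"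
    using geometric_sums[of "1 - q"] assms by simp
  then have "(\<Sum>k. ennreal ((1 - q) ^ k)) = ennreal (1 / q)"
    using assms by (intro suminf_ennreal_eq) auto
  then show ?thesis using assms by (simp add: ennreal_power)
qed

text \<open>Isolates the classical argument. The quantum part enters only through
  \<open>success\<close>: on accepted rounds the law of the sample is \<open>q\<close> times the
  target, while its law on rejected rounds is left open.\<close>

locale rejection_sampling = prob_space S
  for S :: "(real \<times> bool) measure" +
  fixes g :: "real \<Rightarrow> ennreal" and q :: real
  assumes sets_S: "sets S = sets (borel \<Otimes>\<^sub>M count_space UNIV)"
    and q_pos: "0 < q"
    and g_measurable [measurable]: "g \<in> borel_measurable borel"
    and g_integral: "(\<integral>\<^sup>+x. g x \<partial>lborel) = 1"
    and success: "\<And>A. A \<in> sets borel \<Longrightarrow>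
      emeasure S (A \<times> {True}) = ennreal q * emeasure (density lborel g) A"
begin

abbreviation R :: "(nat \<Rightarrow> real \<times> bool) measure" where
  "R \<equiv> \<Pi>\<^sub>M k\<in>UNIV. S"

sublocale P: sequence_space S ..

lemma space_S: "space S = UNIV"
  using sets_eq_imp_space_eq[OF sets_S] by (simp add: space_pair_measure)

lemma fst_snd_measurable [measurable]: "fst \<in> borel_measurable S" "Measurable.pred S snd"
  unfolding measurable_cong_sets[OF sets_S refl] by measurable

lemma space_R: "space R = UNIV"
  by (simp add: space_PiM space_S)

lemma component_measurable [measurable]:
  "(\<lambda>\<omega>. fst (\<omega> k)) \<in> borel_measurable R" "Measurable.pred R (\<lambda>\<omega>. snd (\<omega> k))"
  by (rule measurable_compose[of "\<lambda>\<omega>. \<omega> k" R S]; simp)+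

lemma in_sets_S: "A \<in> sets borel \<Longrightarrow> A \<times> {b} \<in> sets S"
  unfolding sets_S by (rule pair_measureI) auto

lemma emeasure_success: "emeasure S (UNIV \<times> {True}) = ennreal q"
  using success[of UNIV] g_integral by (simp add: emeasure_density)

text \<open>\<open>q\<close> is the probability of success in one round.\<close>

lemma q_le_1: "q \<le> 1"
  using emeasure_success emeasure_le_1[of "UNIV \<times> {True}"] by simp

lemma emeasure_failure: "emeasure S (UNIV \<times> {False}) = ennreal (1 - q)"
proof -
  have "UNIV \<times> {False} = space S - UNIV \<times> {True}" by (auto simp: space_S)
  then have "emeasure S (UNIV \<times> {False}) = 1 - ennreal q"
    using emeasure_compl[of "UNIV \<times> {True}" S] in_sets_S[of UNIV True]
    by (simp add: emeasure_success emeasure_space_1)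
  then show ?thesis using q_pos by (simp add: ennreal_minus flip: ennreal_1)
qed

lemma emeasure_failures:
  "emeasure R {\<omega>. \<forall>i<k. \<not> snd (\<omega> i)} = ennreal (1 - q) ^ k"
proof -
  have "emeasure R {\<omega> \<in> space R. \<forall>i\<in>{..<k}. \<omega> i \<in> UNIV \<times> {False}} = (\<Prod>i<k. emeasure S (UNIV \<times> {False}))"
    by (rule P.emeasure_PiM_Collect) (auto intro: in_sets_S)
  then show ?thesis by (simp add: space_R emeasure_failure mem_Times_iff lessThan_def)
qed

lemma emeasure_first_success:
  assumes "A \<in> sets borel"
  shows "emeasure R {\<omega>. (\<forall>i<k. \<not> snd (\<omega> i)) \<and> snd (\<omega> k) \<and> fst (\<omega> k) \<in> A} =
    ennreal (1 - q) ^ k * (ennreal q * emeasure (density lborel g) A)"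
proof -
  \<comment> \<open>The event as a box in the product space: rejection with any sample before round
    \<open>k\<close>, acceptance with sample in \<open>A\<close> at round \<open>k\<close>.\<close>
  let ?X = "\<lambda>i. if i < k then UNIV \<times> {False} else A \<times> {True}"
  have "emeasure R {\<omega> \<in> space R. \<forall>i\<in>{..k}. \<omega> i \<in> ?X i} = (\<Prod>i\<in>{..k}. emeasure S (?X i))"
    by (rule P.emeasure_PiM_Collect) (auto intro: in_sets_S assms)
  also have "{\<omega> \<in> space R. \<forall>i\<in>{..k}. \<omega> i \<in> ?X i} =
      {\<omega>. (\<forall>i<k. \<not> snd (\<omega> i)) \<and> snd (\<omega> k) \<and> fst (\<omega> k) \<in> A}"
  proof -
    have "(\<forall>i\<in>{..k}. \<omega> i \<in> ?X i) \<longleftrightarrow> (\<forall>i<k. \<omega> i \<in> ?X i) \<and> \<omega> k \<in> ?X k" for \<omega>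
      unfolding Ball_def atMost_iff le_less by blast
    moreover have "(\<forall>i<k. \<omega> i \<in> ?X i) \<longleftrightarrow> (\<forall>i<k. \<not> snd (\<omega> i))" for \<omega>
      by (simp add: mem_Times_iff)
    ultimately show ?thesis by (simp add: space_R mem_Times_iff conj_commute)
  qed
  also have "(\<Prod>i\<in>{..k}. emeasure S (?X i)) =
      ennreal (1 - q) ^ k * (ennreal q * emeasure (density lborel g) A)"
  proof -
    have "(\<Prod>i\<in>{..k}. emeasure S (?X i)) = (\<Prod>i<k. emeasure S (?X i)) * emeasure S (?X k)"
      unfolding lessThan_Suc_atMost[symmetric] by (rule prod.lessThan_Suc)
    also have "(\<Prod>i<k. emeasure S (?X i)) = (\<Prod>i<k. ennreal (1 - q))"
      by (rule prod.cong) (simp_all add: emeasure_failure)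
    finally show ?thesis by (simp add: success[OF assms])
  qed
  finally show ?thesis .
qed

lemma sample_output_measurable [measurable]: "sample_output first_success \<in> borel_measurable R"
proof -
  have "(\<lambda>\<omega>. if \<exists>k. snd (\<omega> k) then fst (\<omega> (LEAST k. snd (\<omega> k))) else 0 :: real) \<in> borel_measurable R"
    by measurable
  then show ?thesis by (simp add: sample_output_first_success[abs_def])
qed

lemma num_uses_measurable [measurable]: "num_uses first_success \<in> borel_measurable R"
  unfolding num_uses_first_success[abs_def] by measurable

lemma suminf_failures: "(\<Sum>k. ennreal (1 - q) ^ k) = ennreal (1 / q)"
  by (rule suminf_geometric_ennreal[OF q_pos q_le_1])

lemma integral_num_uses: "(\<integral>\<^sup>+\<omega>. num_uses first_success \<omega> \<partial>R) = ennreal (1 / q)"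
proof -
  have "{\<omega> \<in> space R. \<forall>i<k. \<not> snd (\<omega> i)} \<in> sets R" for k :: nat
    by measurable
  then have "(\<integral>\<^sup>+\<omega>. num_uses first_success \<omega> \<partial>R) = (\<Sum>k. emeasure R {\<omega>. \<forall>i<k. \<not> snd (\<omega> i)})"
    unfolding num_uses_first_success by (subst nn_integral_suminf) (simp_all add: space_R)
  then show ?thesis by (simp add: emeasure_failures suminf_failures)
qed

text \<open>The event splits by the index of the first success. The geometric series contributes
  \<open>1 / q\<close>, cancelling the factor \<open>q\<close> from the accepted round, so the
  target law remains unscaled.\<close>

lemma emeasure_ex_first_success:
  assumes [measurable]: "A \<in> sets borel"
  shows "emeasure R {\<omega>. \<exists>k. (\<forall>i<k. \<not> snd (\<omega> i)) \<and> snd (\<omega> k) \<and> fst (\<omega> k) \<in> A} =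
    emeasure (density lborel g) A"
proof -
  define F where "F k = {\<omega>. (\<forall>i<k. \<not> snd (\<omega> i)) \<and> snd (\<omega> k) \<and> fst (\<omega> k) \<in> A}" for k :: nat
  have "{\<omega> \<in> space R. (\<forall>i<k. \<not> snd (\<omega> i)) \<and> snd (\<omega> k) \<and> fst (\<omega> k) \<in> A} \<in> sets R" for k :: nat
    by measurable
  then have F: "range F \<subseteq> sets R" by (auto simp: F_def space_R)
  have "disjoint_family F"
    unfolding disjoint_family_on_def
  proof (intro ballI impI)
    fix j k :: nat assume "j \<noteq> k"
    \<comment> \<open>For j < k, \<open>F k\<close> requires failure in round j and
      \<open>F j\<close> success there.\<close>
    then show "F j \<inter> F k = {}" by (cases j k rule: linorder_cases) (auto simp: F_def)
  qed
  then have "emeasure R (\<Union>k. F k) = (\<Sum>k. emeasure R (F k))"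
    using F by (simp add: suminf_emeasure)
  also have "\<dots> = ennreal (1 / q) * (ennreal q * emeasure (density lborel g) A)"
    unfolding F_def by (simp add: emeasure_first_success suminf_failures)
  also have "\<dots> = emeasure (density lborel g) A"
    using q_pos by (simp add: mult.assoc[symmetric] flip: ennreal_mult)
  also have "(\<Union>k. F k) = {\<omega>. \<exists>k. (\<forall>i<k. \<not> snd (\<omega> i)) \<and> snd (\<omega> k) \<and> fst (\<omega> k) \<in> A}"
    by (auto simp: F_def)
  finally show ?thesis .
qed

lemma AE_halts: "AE \<omega> in R. halts first_success \<omega>"
proof -
  have "emeasure R {\<omega>. \<exists>k. (\<forall>i<k. \<not> snd (\<omega> i)) \<and> snd (\<omega> k) \<and> fst (\<omega> k) \<in> (UNIV :: real set)} = 1"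
    using emeasure_ex_first_success[of UNIV] g_integral by (simp add: emeasure_density)
  moreover have "(\<exists>k. (\<forall>i<k. \<not> snd (\<omega> i)) \<and> snd (\<omega> k) \<and> fst (\<omega> k) \<in> (UNIV :: real set)) \<longleftrightarrow> (\<exists>k. snd (\<omega> k))"
    for \<omega> :: "nat \<Rightarrow> real \<times> bool"
    using exists_least_iff[of "\<lambda>k. snd (\<omega> k)"] by auto
  ultimately have "emeasure R {\<omega> \<in> space R. \<exists>k. snd (\<omega> k)} = 1"
    by (simp add: space_R)
  then have "AE \<omega> in R. \<exists>k. snd (\<omega> k)"
    by (subst P.P.AE_iff_emeasure_eq_1) (simp_all)
  then show ?thesis by (simp add: halts_first_success)
qed

lemma distributed_sample_output: "distributed R lborel (sample_output first_success) g"
  unfolding distributed_def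
proof (intro conjI)
  show "distr R lborel (sample_output first_success) = density lborel g"
  proof (rule measure_eqI)
    fix A assume "A \<in> sets (distr R lborel (sample_output first_success))"
    then have A [measurable]: "A \<in> sets borel" by simp
    let ?F = "{\<omega>. \<exists>k. (\<forall>i<k. \<not> snd (\<omega> i)) \<and> snd (\<omega> k) \<and> fst (\<omega> k) \<in> A}"
    have "?F = {\<omega> \<in> space R. \<exists>k. (\<forall>i<k. \<not> snd (\<omega> i)) \<and> snd (\<omega> k) \<and> fst (\<omega> k) \<in> A}"
      by (simp add: space_R)
    also have "\<dots> \<in> sets R" by measurable
    finally have F: "?F \<in> sets R" .
    have first: "(LEAST k. snd (\<omega> k)) = k" if "snd (\<omega> k)" "\<forall>i<k. \<not> snd (\<omega> i)"
      for \<omega> :: "nat \<Rightarrow> real \<times> bool" and k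
      by (rule Least_equality) (use that not_less in blast)+
    \<comment> \<open>Only on halting runs: otherwise the output is the default 0, which may lie in
      \<open>A\<close> although no round succeeds. Almost sure halting makes this harmless.\<close>
    have "sample_output first_success \<omega> \<in> A \<longleftrightarrow> \<omega> \<in> ?F" if "halts first_success \<omega>" for \<omega>
      using that exists_least_iff[of "\<lambda>k. snd (\<omega> k)"] first
      by (auto simp: halts_first_success sample_output_first_success)
    then have "AE \<omega> in R. \<omega> \<in> sample_output first_success -` A \<inter> space R \<longleftrightarrow> \<omega> \<in> ?F"
      using AE_halts by (auto simp: space_R elim!: eventually_mono)
    then have "emeasure R (sample_output first_success -` A \<inter> space R) = emeasure R ?F"
      by (rule emeasure_eq_AE) (use F in auto)
    then show "emeasure (distr R lborel (sample_output first_success)) A = emeasure (density lborel g) A"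
      by (simp add: emeasure_distr emeasure_ex_first_success)
  qed simp
qed simp_all

end

section \<open>The law of a round\<close>

lemma nn_integral_pair_bool:
  assumes [measurable]: "F \<in> borel_measurable (lborel \<Otimes>\<^sub>M count_space (UNIV :: bool set))"
  shows "(\<integral>\<^sup>+z. F z \<partial>(lborel \<Otimes>\<^sub>M count_space UNIV)) = (\<integral>\<^sup>+x. F (x, True) + F (x, False) \<partial>lborel)"
proof -
  interpret sigma_finite_measure "count_space (UNIV :: bool set)"
    by (rule sigma_finite_measure_count_space_finite) simp
  show ?thesis
    by (subst nn_integral_fst[symmetric])
      (simp_all only: assms, simp add: nn_integral_count_space_finite UNIV_bool add.commute)
qed

lemma density_bool_measurable:
  fixes f1 f0 :: "real \<Rightarrow> real"
  assumes [measurable]: "f1 \<in> borel_measurable borel" "f0 \<in> borel_measurable borel"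
  shows "(\<lambda>(x, b). ennreal (if b then f1 x else f0 x))
    \<in> borel_measurable (lborel \<Otimes>\<^sub>M count_space (UNIV :: bool set))"
  by measurable

lemma nn_integral_translate:
  fixes f :: "real \<Rightarrow> ennreal"
  assumes [measurable]: "f \<in> borel_measurable borel"
  shows "(\<integral>\<^sup>+x. f (x - t) \<partial>lborel) = (\<integral>\<^sup>+x. f x \<partial>lborel)"
  using nn_integral_real_affine[of f 1 "- t"] by simp

lemma spectral_conv_nonneg:
  assumes "prob_density \<nu>"
  shows "0 \<le> spectral_conv n E e \<psi> \<nu> x"
  using assms by (auto simp: spectral_conv_def spectral_weight_def prob_density_def intro!: sum_nonneg)

lemma spectral_conv_measurable:
  assumes "prob_density \<nu>"
  shows "spectral_conv n E e \<psi> \<nu> \<in> borel_measurable borel"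
proof -
  have [measurable]: "\<nu> \<in> borel_measurable borel" using assms by (simp add: prob_density_def)
  show ?thesis unfolding spectral_conv_def[abs_def] by measurable
qed

text \<open>Each translate of \<nu> has integral 1 by translation invariance, and the weights sum to
  1 by Parseval.\<close>

lemma nn_integral_spectral_conv:
  assumes \<nu>: "prob_density \<nu>" and H: "spectral_decomposition (2 ^ n) H E e" and \<psi>: "qubit_state n \<psi>"
  shows "(\<integral>\<^sup>+x. ennreal (spectral_conv n E e \<psi> \<nu> x) \<partial>lborel) = 1"
proof -
  have [measurable]: "\<nu> \<in> borel_measurable borel" and \<nu>0: "\<And>x. 0 \<le> \<nu> x"
    and \<nu>1: "(\<integral>\<^sup>+x. ennreal (\<nu> x) \<partial>lborel) = 1"
    using \<nu> by (auto simp: prob_density_def)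
  have w0: "0 \<le> spectral_weight e \<psi> i" for i by (simp add: spectral_weight_def)
  have "(\<integral>\<^sup>+x. ennreal (spectral_conv n E e \<psi> \<nu> x) \<partial>lborel) =
      (\<integral>\<^sup>+x. (\<Sum>i<2 ^ n. ennreal (spectral_weight e \<psi> i) * ennreal (\<nu> (x - E i))) \<partial>lborel)"
    unfolding spectral_conv_def
    by (subst sum_ennreal[symmetric]) (simp_all add: w0 \<nu>0 ennreal_mult)
  also have "\<dots> = (\<Sum>i<2 ^ n. ennreal (spectral_weight e \<psi> i) * (\<integral>\<^sup>+x. ennreal (\<nu> (x - E i)) \<partial>lborel))"
    by (simp add: nn_integral_sum nn_integral_cmult)
  also have "\<dots> = (\<Sum>i<2 ^ n. ennreal (spectral_weight e \<psi> i))"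
    using nn_integral_translate[of "\<lambda>x. ennreal (\<nu> x)"] by (simp add: \<nu>1)
  also have "\<dots> = ennreal (\<Sum>i<2 ^ n. spectral_weight e \<psi> i)"
    using w0 by (simp add: sum_ennreal)
  also have "\<dots> = 1"
    using sum_spectral_weight[OF H, of \<psi>] \<psi> by (simp add: qubit_state_def)
  finally show ?thesis .
qed

lemma rejection_sampling_round_measure:
  assumes \<mu>: "prob_density \<mu>"
    and g: "g \<in> borel_measurable borel" "\<And>x. 0 \<le> g x" "(\<integral>\<^sup>+x. ennreal (g x) \<partial>lborel) = 1"
    and c: "0 < c"
    and U: "\<And>x. x \<in> supp \<mu> \<Longrightarrow> unitary_mat (2 ^ (n + m)) (U x)" and \<psi>: "qubit_state n \<psi>"
    and accept: "\<And>x. \<mu> x * ancilla_prob n m \<psi> (U x) 0 = c * g x"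
  shows "rejection_sampling (round_measure n m \<mu> \<psi> U) (\<lambda>x. ennreal (g x)) c"
proof -
  let ?B = "lborel \<Otimes>\<^sub>M count_space (UNIV :: bool set)"
  \<comment> \<open>The round density rewritten in terms of \<mu> and \<open>g\<close>, which are
    measurable, whereas nothing is known about measurability of \<open>U\<close>.\<close>
  let ?D = "\<lambda>(x, b). ennreal (if b then c * g x else \<mu> x - c * g x)"
  have \<mu>_meas [measurable]: "\<mu> \<in> borel_measurable borel" and \<mu>0: "\<And>x. 0 \<le> \<mu> x"
    and \<mu>1: "(\<integral>\<^sup>+x. ennreal (\<mu> x) \<partial>lborel) = 1"
    using \<mu> by (auto simp: prob_density_def)
  note [measurable] = g(1)
  \<comment> \<open>Where \<mu> vanishes, \<open>U x\<close> may fail to be unitary, but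
    \<open>accept\<close> forces \<open>c * g x = 0\<close>. Elsewhere the Born probabilities sum to
    1.\<close>
  have reject: "\<mu> x * (\<Sum>a\<in>{1..<2 ^ m}. ancilla_prob n m \<psi> (U x) a) = \<mu> x - c * g x" for x
  proof (cases "\<mu> x = 0")
    case True
    then show ?thesis using accept[of x] by simp
  next
    case False
    then have "(\<Sum>a<2 ^ m. ancilla_prob n m \<psi> (U x) a) = 1"
      using U \<psi> by (intro sum_ancilla_prob) (simp_all add: supp_def)
    moreover have "{..<2 ^ m} = insert 0 {1..<2 ^ m :: nat}" by auto
    ultimately have "(\<Sum>a\<in>{1..<2 ^ m}. ancilla_prob n m \<psi> (U x) a) = 1 - ancilla_prob n m \<psi> (U x) 0"
      by simp
    then show ?thesis using accept[of x] by (simp add: right_diff_distrib)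
  qed
  \<comment> \<open>Domination of \<open>c * g\<close> by \<mu>, read off from nonnegativity of the
    rejection density. It prevents \<open>ennreal\<close> from truncating the difference, so that
    the total mass is that of \<mu>.\<close>
  have le: "c * g x \<le> \<mu> x" for x
  proof -
    have "0 \<le> \<mu> x * (\<Sum>a\<in>{1..<2 ^ m}. ancilla_prob n m \<psi> (U x) a)"
      using \<mu>0 by (intro mult_nonneg_nonneg sum_nonneg) (auto simp: ancilla_prob_def)
    then show ?thesis unfolding reject by simp
  qed
  have D: "?D \<in> borel_measurable ?B"
    by (rule density_bool_measurable) measurable
  have S: "round_measure n m \<mu> \<psi> U = density ?B ?D"
    unfolding round_measure_def
  proof (intro arg_cong[of _ _ "density ?B"] ext)
    fix z :: "real \<times> bool"
    obtain x b where z: "z = (x, b)" by (cases z)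
    show "(case z of (x, b) \<Rightarrow> ennreal (\<mu> x *
        (if b then ancilla_prob n m \<psi> (U x) 0
         else (\<Sum>a\<in>{1..<2 ^ m}. ancilla_prob n m \<psi> (U x) a)))) = ?D z"
      unfolding z prod.case by (cases b) (simp_all only: if_True if_False accept reject)
  qed
  have sets_B: "sets ?B = sets (borel \<Otimes>\<^sub>M count_space UNIV)"
    by (rule sets_pair_measure_cong) auto
  have emeasure_S: "emeasure (density ?B ?D) X =
      (\<integral>\<^sup>+x. ennreal (c * g x) * indicator X (x, True) + ennreal (\<mu> x - c * g x) * indicator X (x, False) \<partial>lborel)"
    if X: "X \<in> sets ?B" for X
  proof -
    have "(\<lambda>z. ?D z * indicator X z) \<in> borel_measurable ?B"
      using D X by measurable
    from nn_integral_pair_bool[OF this] show ?thesis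
      using D X by (simp add: emeasure_density)
  qed
  have "emeasure (density ?B ?D) (space (density ?B ?D)) =
      (\<integral>\<^sup>+x. ennreal (c * g x) + ennreal (\<mu> x - c * g x) \<partial>lborel)"
    using emeasure_S[OF sets.top] by (simp add: space_pair_measure)
  also have "\<dots> = (\<integral>\<^sup>+x. ennreal (\<mu> x) \<partial>lborel)"
    using g(2) c le by (intro nn_integral_cong) (simp flip: ennreal_plus)
  finally have prob: "prob_space (density ?B ?D)" using \<mu>1 by (intro prob_spaceI) simp
  have success: "emeasure (density ?B ?D) (A \<times> {True}) =
      ennreal c * emeasure (density lborel (\<lambda>x. ennreal (g x))) A" if [measurable]: "A \<in> sets borel" for A
  proof -
    have "A \<times> {True} \<in> sets ?B" by (rule pair_measureI) auto
    then have "emeasure (density ?B ?D) (A \<times> {True}) =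
        (\<integral>\<^sup>+x. ennreal (c * g x) * indicator (A \<times> {True}) (x, True) +
          ennreal (\<mu> x - c * g x) * indicator (A \<times> {True}) (x, False) \<partial>lborel)"
      by (rule emeasure_S)
    also have "\<dots> = (\<integral>\<^sup>+x. ennreal c * (ennreal (g x) * indicator A x) \<partial>lborel)"
      using c g(2) by (intro nn_integral_cong) (auto simp: ennreal_mult indicator_def)
    also have "\<dots> = ennreal c * emeasure (density lborel (\<lambda>x. ennreal (g x))) A"
      by (simp add: nn_integral_cmult emeasure_density)
    finally show ?thesis .
  qed
  show ?thesis
    unfolding S rejection_sampling_def rejection_sampling_axioms_def
    using prob c g(3) success sets_B by auto
qed

lemma (in rejection_sampling) generates_sample_first_success:
  assumes "S = round_measure n m \<mu> \<psi> U" "g = (\<lambda>x. ennreal (f x))"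
  shows "generates_sample first_success n m \<mu> \<psi> U f (1 / q)"
  unfolding generates_sample_def rounds_measure_def Let_def assms(1)[symmetric] assms(2)[symmetric]
  using P.P.prob_space_axioms AE_halts distributed_sample_output num_uses_measurable integral_num_uses
  by blast

section \<open>From the block-encoding to the acceptance probability\<close>

text \<open>The convolution needs \<nu> at \<open>x - E i\<close>. These are the eigenvalues of xI -
  H; those of H - xI have the opposite sign, which an even \<nu> absorbs.\<close>

lemma accept_probability:
  assumes H: "spectral_decomposition (2 ^ n) H E e" and \<psi>: "qubit_state n \<psi>"
    and U: "block_encoding n 1 m 0 A V"
    and A: "(\<forall>y. \<nu> (- y) = \<nu> y) \<and>
        abs_sq A = complex_of_real c \<cdot>\<^sub>m op_fun (\<lambda>y. complex_of_real (\<nu> y)) (H - scalar_op n x) \<or>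
      abs_sq A = complex_of_real c \<cdot>\<^sub>m op_fun (\<lambda>y. complex_of_real (\<nu> y)) (scalar_op n x - H)"
  shows "ancilla_prob n m \<psi> V 0 = c * spectral_conv n E e \<psi> \<nu> x"
proof -
  have Ac: "A \<in> carrier_mat (2 ^ n) (2 ^ n)" using U unfolding block_encoding_def by blast
  have \<psi>d: "dim_vec \<psi> = 2 ^ n" using \<psi> by (simp add: qubit_state_def)
  have Hc: "dim_row H = 2 ^ n" "dim_col H = 2 ^ n"
    using H by (simp_all add: spectral_decomposition_def spectral_sum_def)
  have "complex_of_real 1 \<cdot>\<^sub>m H + complex_of_real (- x) \<cdot>\<^sub>m 1\<^sub>m (2 ^ n) = H - scalar_op n x"
    by (rule eq_matI) (simp_all add: scalar_op_def Hc)
  then have minus: "spectral_decomposition (2 ^ n) (H - scalar_op n x) (\<lambda>i. 1 * E i + - x) e"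
    using spectral_decomposition_affine[OF H, of 1 "- x"] by (simp only:)
  have "complex_of_real (- 1) \<cdot>\<^sub>m H + complex_of_real x \<cdot>\<^sub>m 1\<^sub>m (2 ^ n) = scalar_op n x - H"
    by (rule eq_matI) (simp_all add: scalar_op_def Hc)
  then have minus': "spectral_decomposition (2 ^ n) (scalar_op n x - H) (\<lambda>i. - 1 * E i + x) e"
    using spectral_decomposition_affine[OF H, of "- 1" x] by (simp only:)
  have "(l2_norm (A *\<^sub>v \<psi>))\<^sup>2 = c * (\<Sum>i<2 ^ n. spectral_weight e \<psi> i * \<nu> (x - E i))"
    using A
  proof (elim disjE conjE)
    assume even: "\<forall>y. \<nu> (- y) = \<nu> y"
      and sq: "abs_sq A = complex_of_real c \<cdot>\<^sub>m op_fun (\<lambda>y. complex_of_real (\<nu> y)) (H - scalar_op n x)"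
    have "\<nu> (1 * E i + - x) = \<nu> (x - E i)" for i
      using even[rule_format, of "x - E i"] by simp
    then show ?thesis
      using l2_norm_abs_sq_op_fun[OF minus Ac \<psi>d sq] by (simp only:)
  next
    assume sq: "abs_sq A = complex_of_real c \<cdot>\<^sub>m op_fun (\<lambda>y. complex_of_real (\<nu> y)) (scalar_op n x - H)"
    have "- 1 * E i + x = x - E i" for i by simp
    then show ?thesis
      using l2_norm_abs_sq_op_fun[OF minus' Ac \<psi>d sq] by (simp only:)
  qed
  then show ?thesis
    by (simp only: ancilla_prob_block_encoding[OF U \<psi>d] spectral_conv_def)
qed

text \<open>The procedure is chosen before H, \<psi>, M and \<open>U\<close>, so it cannot encode
  knowledge of them. The disjunction in the hypotheses covers the two sign conventions for the
  argument of \<nu>.\<close>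

theorem theorem2p5:
  fixes n m :: nat and \<nu> \<mu> :: "real \<Rightarrow> real"
  assumes "prob_density \<nu>" and "prob_density \<mu>"
  shows "\<exists>proc :: procedure.
    \<forall>(H :: complex mat) (E :: nat \<Rightarrow> real) (e :: nat \<Rightarrow> complex vec) (\<psi> :: complex vec)
     (M :: complex) (h :: real \<Rightarrow> real \<Rightarrow> complex) (U :: real \<Rightarrow> complex mat).
      spectral_decomposition (2 ^ n) H E e \<longrightarrow>
      qubit_state n \<psi> \<longrightarrow>
      supp (spectral_conv n E e \<psi> \<nu>) \<subseteq> supp \<mu> \<longrightarrow>
      M \<noteq> 0 \<longrightarrow>
      (\<forall>x \<in> supp \<mu>.
         block_encoding n 1 m 0 (op_fun (h x) (H - scalar_op n x)) (U x) \<and>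
         op_norm (op_fun (h x) (H - scalar_op n x)) \<le> 1) \<longrightarrow>
      ((\<forall>y. \<nu> (- y) = \<nu> y) \<and>
       (\<forall>x \<in> supp \<mu>.
          abs_sq (op_fun (h x) (H - scalar_op n x)) =
          complex_of_real (1 / ((cmod M)\<^sup>2 * \<mu> x)) \<cdot>\<^sub>m
            op_fun (\<lambda>y. complex_of_real (\<nu> y)) (H - scalar_op n x))
       \<or>
       (\<forall>x \<in> supp \<mu>.
          abs_sq (op_fun (h x) (H - scalar_op n x)) =
          complex_of_real (1 / ((cmod M)\<^sup>2 * \<mu> x)) \<cdot>\<^sub>m
            op_fun (\<lambda>y. complex_of_real (\<nu> y)) (scalar_op n x - H))) \<longrightarrow>
      generates_sample proc n m \<mu> \<psi> U (spectral_conv n E e \<psi> \<nu>) ((cmod M)\<^sup>2)"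
proof (intro exI[of _ first_success] allI impI)
  fix H :: "complex mat" and E :: "nat \<Rightarrow> real" and e :: "nat \<Rightarrow> complex vec" and \<psi> :: "complex vec"
    and M :: complex and h :: "real \<Rightarrow> real \<Rightarrow> complex" and U :: "real \<Rightarrow> complex mat"
  let ?g = "spectral_conv n E e \<psi> \<nu>"
  let ?A = "\<lambda>x. op_fun (h x) (H - scalar_op n x)"
  let ?c = "\<lambda>x. 1 / ((cmod M)\<^sup>2 * \<mu> x)"
  assume H: "spectral_decomposition (2 ^ n) H E e" and \<psi>: "qubit_state n \<psi>"
    and supp: "supp ?g \<subseteq> supp \<mu>" and M: "M \<noteq> 0"
    and U: "\<forall>x \<in> supp \<mu>. block_encoding n 1 m 0 (?A x) (U x) \<and> op_norm (?A x) \<le> 1"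
    and A: "(\<forall>y. \<nu> (- y) = \<nu> y) \<and>
       (\<forall>x \<in> supp \<mu>. abs_sq (?A x) =
          complex_of_real (?c x) \<cdot>\<^sub>m op_fun (\<lambda>y. complex_of_real (\<nu> y)) (H - scalar_op n x)) \<or>
       (\<forall>x \<in> supp \<mu>. abs_sq (?A x) =
          complex_of_real (?c x) \<cdot>\<^sub>m op_fun (\<lambda>y. complex_of_real (\<nu> y)) (scalar_op n x - H))"
  \<comment> \<open>On the support of \<mu> the factor \<open>\<mu> x\<close> cancels against the
    one in \<open>?c x\<close>.\<close>
  have accept: "\<mu> x * ancilla_prob n m \<psi> (U x) 0 = 1 / (cmod M)\<^sup>2 * ?g x" for x
  proof (cases "x \<in> supp \<mu>")
    case True
    have "block_encoding n 1 m 0 (?A x) (U x)" using U True by blast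
    then have "ancilla_prob n m \<psi> (U x) 0 = ?c x * ?g x"
      by (rule accept_probability[OF H \<psi>]) (use A True in blast)
    then show ?thesis using True by (simp add: supp_def)
  next
    case False
    then show ?thesis using supp by (auto simp: supp_def)
  qed
  have "rejection_sampling (round_measure n m \<mu> \<psi> U) (\<lambda>x. ennreal (?g x)) (1 / (cmod M)\<^sup>2)"
  proof (rule rejection_sampling_round_measure)
    show "unitary_mat (2 ^ (n + m)) (U x)" if "x \<in> supp \<mu>" for x
      using U that unfolding block_encoding_def by blast
  qed (use assms H \<psi> M accept in \<open>simp_all add: spectral_conv_measurable spectral_conv_nonneg nn_integral_spectral_conv\<close>)
  then show "generates_sample first_success n m \<mu> \<psi> U ?g ((cmod M)\<^sup>2)"
    using rejection_sampling.generates_sample_first_success[OF _ refl refl, of n m \<mu> \<psi> U ?g "1 / (cmod M)\<^sup>2"]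
    by simp
qed

end
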